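(* Let $\gamma$ be a parameterized smooth simple closed regular curve in the plane and let $O$ be a point not on any tangent line to $\gamma$ (so that $\gamma$ is star-shaped with respect to $O$). Then $CCM(\gamma)=CM(\gamma)$.
   Context: Take $O$ as the origin. The Circumcenter of Mass of $\gamma$ is $$CCM(\gamma)=\frac{\int C(t)\,dA}{\int dA},$$ the integrals being taken over one period of $\gamma$, where $C(t)$ is the limit, as $\varepsilon\to0$, of the vector from $O$ to the circumcenter of the triangle $O\,\gamma(t)\,\gamma(t+\varepsilon)$, and $dA=\tfrac12\det(\gamma(t),\gamma'(t))\,dt$ is the (signed) area of the infinitesimal triangle $O\,\gamma(t)\,\gamma(t+dt)$. $CM(\gamma)$ is the center of mass of the homogeneous lamina bounded by $\gamma$ (as a vector from $O$). *)

theory Defs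
  imports "HOL-Analysis.Analysis"
begin

definition smooth :: "(real \<Rightarrow> real^2) \<Rightarrow> bool" where
  "smooth \<gamma> \<longleftrightarrow>
     (\<forall>k t. ((\<lambda>f s. vector_derivative f (at s)) ^^ k) \<gamma> differentiable (at t))"

text \<open>The curve is given by a \<open>T\<close>-periodic map on the whole line; simplicity is injectivity
  on a half-open period, which also makes \<open>T\<close> the least period.\<close>

definition smooth_simple_closed_regular_curve :: "real \<Rightarrow> (real \<Rightarrow> real^2) \<Rightarrow> bool" where
  "smooth_simple_closed_regular_curve T \<gamma> \<longleftrightarrow>
     0 < T \<and> (\<forall>t. \<gamma> (t + T) = \<gamma> t) \<and> smooth \<gamma> \<and> inj_on \<gamma> {0..<T} \<and>
     (\<forall>t. vector_derivative \<gamma> (at t) \<noteq> 0)"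

definition tangent_line :: "(real \<Rightarrow> real^2) \<Rightarrow> real \<Rightarrow> (real^2) set" where
  "tangent_line \<gamma> t = {\<gamma> t + s *\<^sub>R vector_derivative \<gamma> (at t) | s. True}"

text \<open>Meaningful only for non-collinear \<open>a\<close>, \<open>b\<close>, \<open>c\<close>.\<close>

definition circumcenter :: "real^2 \<Rightarrow> real^2 \<Rightarrow> real^2 \<Rightarrow> real^2" where
  "circumcenter a b c = (THE x. dist x a = dist x b \<and> dist x a = dist x c)"

text \<open>Below, \<open>p\<close> is an arbitrary base point, and \<open>limit_circumcenter\<close>, \<open>CCM\<close> and \<open>CM\<close> are
  vectors issuing from \<open>p\<close>. If \<open>p\<close> lies on no tangent line of \<open>\<gamma>\<close>, the triangle
  \<open>p\<close>, \<open>\<gamma> t\<close>, \<open>\<gamma> (t + \<epsilon>)\<close> is nondegenerate for all small \<open>\<epsilon> \<noteq> 0\<close> and the limit exists.\<close>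

definition limit_circumcenter :: "real^2 \<Rightarrow> (real \<Rightarrow> real^2) \<Rightarrow> real \<Rightarrow> real^2" where
  "limit_circumcenter p \<gamma> t =
     Lim (at 0) (\<lambda>\<epsilon>. circumcenter p (\<gamma> t) (\<gamma> (t + \<epsilon>)) - p)"

definition area_density :: "real^2 \<Rightarrow> (real \<Rightarrow> real^2) \<Rightarrow> real \<Rightarrow> real" where
  "area_density p \<gamma> t =
     det (vector [\<gamma> t - p, vector_derivative \<gamma> (at t)] :: real^2^2) / 2"

definition CCM :: "real^2 \<Rightarrow> real \<Rightarrow> (real \<Rightarrow> real^2) \<Rightarrow> real^2" where
  "CCM p T \<gamma> =
     integral {0..T} (\<lambda>t. area_density p \<gamma> t *\<^sub>R limit_circumcenter p \<gamma> t)
       /\<^sub>R integral {0..T} (area_density p \<gamma>)"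

definition center_of_mass :: "(real^2) set \<Rightarrow> real^2" where
  "center_of_mass S = integral S (\<lambda>x. x) /\<^sub>R measure lebesgue S"

definition CM :: "real^2 \<Rightarrow> (real \<Rightarrow> real^2) \<Rightarrow> real^2" where
  "CM p \<gamma> = center_of_mass (inside (range \<gamma>)) - p"

end

theory Submission
  imports Defs "HOL-Complex_Analysis.Winding_Numbers"
begin

text \<open>
  Put \<open>u = \<gamma> - p\<close> and \<open>w = det (u, u')\<close>, which has no zeros. The circle through \<open>p\<close> tangent to the curve
  at \<open>\<gamma> t\<close> has its center at \<open>p + c\<close>, where \<open>2 w c\<close> is \<open>|u|\<^sup>2 u' - 2 (u \<bullet> u') u\<close> rotated by a right
  angle. A computation shows that \<open>(w / 2) c - (w / 3) u\<close> is the derivative of \<open>- |u|\<^sup>2 u / 12\<close>, rotated in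
  the same way, so both terms have the same integral over a period.

  On the other hand \<open>(w / 3) u dt\<close> is the first moment of the infinitesimal triangle at \<open>p\<close>. To
  integrate these triangles to the lamina, one needs that each ray from \<open>p\<close> meets the curve exactly
  once: as \<open>w\<close> has constant sign, the argument of \<open>u\<close> is strictly monotone, hence the winding number
  is nonzero, and then it is \<open>1\<close> or \<open>-1\<close> because the curve is simple.
\<close>

section \<open>Closed curves turning left around the origin\<close>

text \<open>Subtracting a whole number of periods, the floor of \<open>t / T\<close>, moves any
  parameter into the half-open period.\<close>

lemma periodic_range:
  fixes g :: "real \<Rightarrow> 'a"
  assumes "0 < T" and periodic: "\<And>t. g (t + T) = g t"
  shows "range g = g ` {0..<T}"
proof -
  interpret periodic_fun_simple g T
    by unfold_locales (rule periodic)
  have "g t \<in> g ` {0..<T}" for t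
  proof
    show "g t = g (t - of_int \<lfloor>t / T\<rfloor> * T)"
      by (simp add: minus_of_int)
    have "of_int \<lfloor>t / T\<rfloor> * T \<le> t"
      using of_int_floor_le[of "t / T"] pos_le_divide_eq[OF \<open>0 < T\<close>] by blast
    moreover have "t < (of_int \<lfloor>t / T\<rfloor> + 1) * T"
      using pos_divide_less_eq[OF \<open>0 < T\<close>] by (metis floor_less_iff floor_add_int floor_one less_add_one of_int_1 of_int_add)
    ultimately show "t - of_int \<lfloor>t / T\<rfloor> * T \<in> {0..<T}"
      by (simp add: algebra_simps)
  qed
  then show ?thesis
    by auto
qed

text \<open>\<open>Im (g' t / g t)\<close> is the angular velocity of \<open>g\<close> about the
  origin, so \<open>turning\<close> makes the argument increase. It also keeps the curve off the
  origin, since a quotient by \<open>0\<close> is \<open>0\<close>.\<close>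

locale closed_curve_turning_left =
  fixes g g' :: "real \<Rightarrow> complex" and T :: real
  assumes period_pos: "0 < T"
    and periodic: "\<And>t. g (t + T) = g t"
    and deriv: "\<And>t. (g has_vector_derivative g' t) (at t)"
    and continuous_deriv: "continuous_on UNIV g'"
    and inj: "inj_on g {0..<T}"
    and turning: "\<And>t. 0 < Im (g' t / g t)"
begin

lemma nonzero: "g t \<noteq> 0"
  using turning[of t] by auto

lemma continuous: "continuous_on S g"
  by (rule continuous_on_vector_derivative[OF has_vector_derivative_at_within[OF deriv]])

text \<open>\<open>lift\<close> is a branch of \<open>log (g / g 0)\<close> along the curve.\<close>

definition lift :: "real \<Rightarrow> complex" where
  "lift t = integral {0..t} (\<lambda>s. g' s / g s)"

lemma lift_0: "lift 0 = 0"
  by (simp add: lift_def)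

lemma lift_deriv:
  assumes "t \<in> {0..T}"
  shows "(lift has_vector_derivative g' t / g t) (at t within {0..T})"
proof -
  have "continuous_on {0..T} (\<lambda>s. g' s / g s)"
    by (intro continuous_intros continuous continuous_on_subset[OF continuous_deriv])
      (auto simp: nonzero)
  from integral_has_vector_derivative[OF this assms] show ?thesis
    by (simp add: lift_def[abs_def])
qed

text \<open>The product of \<open>g\<close> with \<open>exp (- lift s)\<close> has derivative zero,
  so it keeps its initial value \<open>g 0\<close>.\<close>

lemma exp_lift:
  assumes "t \<in> {0..T}"
  shows "g t = g 0 * exp (lift t)"
proof -
  have "((\<lambda>s. g s * exp (- lift s)) has_derivative (\<lambda>h. 0)) (at s within {0..T})"
    if "s \<in> {0..T}" for s
  proof -
    have "((\<lambda>s. exp (- lift s)) has_vector_derivative - (g' s / g s) * exp (- lift s)) (at s within {0..T})"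
      using field_vector_diff_chain_within[where g = exp and g' = "exp (- lift s)",
          OF has_vector_derivative_minus[OF lift_deriv[OF that]]] DERIV_exp
      by (simp add: o_def has_field_derivative_at_within)
    from has_vector_derivative_mult[OF has_vector_derivative_at_within[OF deriv] this]
    have "((\<lambda>s. g s * exp (- lift s)) has_vector_derivative 0) (at s within {0..T})"
      by (simp add: nonzero field_simps)
    then show ?thesis
      by (simp add: has_vector_derivative_def)
  qed
  then obtain c where c: "\<And>s. s \<in> {0..T} \<Longrightarrow> g s * exp (- lift s) = c"
    using has_derivative_zero_constant[of "{0..T}" "\<lambda>s. g s * exp (- lift s)"] by force
  from c[of 0] c[OF assms] period_pos show ?thesis
    by (simp add: lift_0 exp_minus field_simps)
qed

lemma strict_mono_Im_lift: "strict_mono_on {0..T} (\<lambda>t. Im (lift t))"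
proof (rule strict_mono_onI)
  fix r s assume rs: "r \<in> {0..T}" "s \<in> {0..T}" "r < s"
  have d: "((\<lambda>t. Im (lift t)) has_real_derivative Im (g' t / g t)) (at t within {0..T})"
    if "t \<in> {0..T}" for t
    using bounded_linear.has_vector_derivative[OF bounded_linear_Im lift_deriv[OF that]]
    by (simp add: has_real_derivative_iff_has_vector_derivative)
  have sub: "{r..s} \<subseteq> {0..T}"
    using rs by auto
  show "Im (lift r) < Im (lift s)"
  proof (rule DERIV_pos_imp_increasing_open[OF rs(3)])
    fix x assume x: "r < x" "x < s"
    \<comment> \<open>At interior points the derivative relative to the period is the two-sided one
      that the monotonicity criterion asks for.\<close>
    then have "at x within {0..T} = at x"
      using rs by (intro at_within_interior) (auto simp: )
    with d[of x] x rs turning[of x]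
    show "\<exists>y. ((\<lambda>t. Im (lift t)) has_real_derivative y) (at x) \<and> 0 < y"
      by auto
  next
    show "continuous_on {r..s} (\<lambda>t. Im (lift t))"
      using d sub by (intro continuous_on_subset[OF _ sub] DERIV_continuous_on) auto
  qed
qed

section \<open>The curve as a loop over the unit interval, and its winding number around the
  origin\<close>

definition loop :: "real \<Rightarrow> complex" where
  "loop x = g (T * x)"

lemma loop_deriv: "(loop has_vector_derivative T *\<^sub>R g' (T * x)) (at x)"
proof -
  have "((\<lambda>x. T * x) has_vector_derivative T) (at x)"
    by (auto intro!: derivative_eq_intros simp: has_real_derivative_iff_has_vector_derivative[symmetric])
  from vector_diff_chain_at[OF this deriv] show ?thesis
    by (simp add: loop_def[abs_def] o_def)
qed

lemma path_image_loop: "path_image loop = range g"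
proof -
  have "g ` {0..<T} \<subseteq> loop ` {0..1}"
  proof safe
    fix t assume "t \<in> {0..<T}"
    then show "g t \<in> loop ` {0..1}"
      using period_pos by (intro image_eqI[of _ _ "t / T"]) (auto simp: loop_def)
  qed
  moreover have "loop ` {0..1} \<subseteq> range g"
    by (auto simp: loop_def)
  ultimately show ?thesis
    using periodic_range[OF period_pos, of g] periodic by (auto simp: path_image_def)
qed

lemma closed_loop: "loop 1 = loop 0"
  using periodic[of 0] by (simp add: loop_def)

lemma simple_path_loop: "simple_path loop"
proof -
  have "x = y \<or> x = 0 \<and> y = 1 \<or> x = 1 \<and> y = 0"
    if xy: "x \<in> {0..1}" "y \<in> {0..1}" and eq: "loop x = loop y" for x y
  proof -
    \<comment> \<open>Moving the endpoint \<open>1\<close> to \<open>0\<close> brings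
      \<open>T * r z\<close> into the half-open period, where \<open>g\<close> is injective.\<close>
    define r where "r z = (if z = 1 then 0 else z)" for z :: real
    have r: "loop (r z) = loop z" "z \<in> {0..1} \<Longrightarrow> T * r z \<in> {0..<T}" for z
      using period_pos by (auto simp: r_def closed_loop)
    then have "T * r x = T * r y"
      using xy eq by (intro inj_onD[OF inj]) (auto simp: loop_def)
    then show ?thesis
      using period_pos by (auto simp: r_def split: if_splits)
  qed
  moreover have "path loop"
    unfolding path_def by (rule continuous_on_vector_derivative[OF has_vector_derivative_at_within[OF loop_deriv]])
  ultimately show ?thesis
    by (auto simp: simple_path_def loop_free_def)
qed

lemma valid_path_loop: "valid_path loop"
  unfolding valid_path_def
proof (rule C1_differentiable_imp_piecewise)
  have "continuous_on {0..1} (\<lambda>x. T *\<^sub>R g' (T * x))"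
    by (intro continuous_intros continuous_on_compose2[OF continuous_deriv]) auto
  then show "loop C1_differentiable_on {0..1}"
    unfolding C1_differentiable_on_def
    by (intro exI[of _ "\<lambda>x. T *\<^sub>R g' (T * x)"]) (simp add: loop_deriv)
qed

text \<open>Since \<open>lift (T * x)\<close> is a primitive of the contour integrand along
  \<open>loop\<close> and starts at \<open>0\<close>, the contour integral of \<open>1 / w\<close>
  is \<open>lift T\<close>.\<close>

lemma winding_number_loop: "winding_number loop 0 = lift T / (2 * pi * \<i>)"
proof -
  have "((\<lambda>w. 1 / (w - 0)) has_contour_integral (lift (T * 1) - lift (T * 0))) loop"
    unfolding has_contour_integral_def
  proof (rule fundamental_theorem_of_calculus)
    fix x :: real assume x: "x \<in> {0..1}"
    have "((\<lambda>x. T * x) has_vector_derivative T) (at x within {0..1})"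
      by (auto intro!: derivative_eq_intros simp: has_real_derivative_iff_has_vector_derivative[symmetric])
    moreover have "(lift has_vector_derivative g' (T * x) / g (T * x)) (at (T * x) within (*) T ` {0..1})"
      using x period_pos
      by (intro has_vector_derivative_within_subset[OF lift_deriv]) (auto simp: mult_left_le)
    ultimately have "((\<lambda>x. lift (T * x)) has_vector_derivative T *\<^sub>R (g' (T * x) / g (T * x))) (at x within {0..1})"
      using vector_diff_chain_within[of "(*) T"] by (auto simp: o_def)
    moreover have "vector_derivative loop (at x within {0..1}) = T *\<^sub>R g' (T * x)"
      using vector_derivative_at_within_ivl[OF loop_deriv] x by simp
    ultimately show "((\<lambda>x. lift (T * x)) has_vector_derivative
        1 / (loop x - 0) * vector_derivative loop (at x within {0..1})) (at x within {0..1})"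
      by (simp add: loop_def scaleR_conv_of_real)
  qed auto
  then have "contour_integral loop (\<lambda>w. 1 / (w - 0)) = lift T"
    by (simp add: contour_integral_unique lift_0)
  moreover have "0 \<notin> path_image loop"
    using nonzero by (auto simp: path_image_loop)
  ultimately show ?thesis
    using winding_number_valid_path[OF valid_path_loop] by simp
qed

text \<open>The Jordan curve theorem enters here: the winding number of a simple closed path is
  \<open>-1\<close>, \<open>0\<close> or \<open>1\<close>, and the argument increases.\<close>

lemma winding_number_loop_eq_1: "winding_number loop 0 = 1"
proof -
  have "0 < Im (lift T)"
    using strict_mono_onD[OF strict_mono_Im_lift, of 0 T] period_pos by (simp add: lift_0)
  moreover have "Re (lift T / (2 * pi * \<i>)) = Im (lift T) / (2 * pi)"
    by (simp add: Re_divide power2_eq_square)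
  ultimately have "0 < Re (winding_number loop 0)"
    by (simp add: winding_number_loop)
  moreover have "winding_number loop 0 \<in> {-1, 0, 1}"
    using nonzero by (intro simple_closed_path_winding_number_cases)
      (auto simp: simple_path_loop closed_loop path_image_loop pathfinish_def pathstart_def)
  ultimately show ?thesis
    by auto
qed

text \<open>Together with \<open>lift 0 = 0\<close> and strict monotonicity, this makes the argument
  take each value in \<open>{0..<2 * pi}\<close> exactly once over a half-open period; both ray
  lemmas below rest on it.\<close>

lemma Im_lift_T: "Im (lift T) = 2 * pi"
  using winding_number_loop winding_number_loop_eq_1 by (simp add: field_simps)

text \<open>The winding number vanishes on the outside of the curve, but it is \<open>1\<close> at
  the origin.\<close>

lemma zero_in_inside: "0 \<in> inside (range g)"
proof -
  have "0 \<notin> outside (path_image loop)"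
    using winding_number_zero_in_outside[of loop 0] winding_number_loop_eq_1 simple_path_loop
    by (auto simp: closed_loop pathfinish_def pathstart_def simple_path_def)
  moreover have "0 \<notin> range g"
    using nonzero by (metis imageE)
  ultimately show ?thesis
    using inside_Un_outside[of "range g"] unfolding path_image_loop by blast
qed

text \<open>Arguments of points on one ray differ by a multiple of \<open>2 * pi\<close>. On the
  half-open period the argument stays in \<open>{0..<2 * pi}\<close>, so the multiple is zero and
  monotonicity identifies the parameters.\<close>

lemma same_ray_imp_eq:
  assumes "s \<in> {0..<T}" "t \<in> {0..<T}" "0 < r" "g s = r *\<^sub>R g t"
  shows "s = t"
proof -
  have I: "0 \<le> Im (lift x)" "Im (lift x) < 2 * pi" if "x \<in> {0..<T}" for x
    using that strict_mono_onD[OF strict_mono_Im_lift, of 0 x]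
      strict_mono_onD[OF strict_mono_Im_lift, of x T] Im_lift_T lift_0 by (cases "x = 0"; force)+
  \<comment> \<open>The scaling by \<open>r\<close> enters through the real number
    \<open>ln r\<close> and leaves the imaginary part alone.\<close>
  have "exp (lift s) = exp (lift t + of_real (ln r))"
    using assms exp_lift[of s] exp_lift[of t] nonzero[of 0]
    by (simp add: exp_add exp_of_real scaleR_conv_of_real)
  then obtain n :: int where "lift s = lift t + of_real (ln r) + (of_int (2 * n) * pi) * \<i>"
    unfolding exp_eq by blast
  then have n: "Im (lift s) = Im (lift t) + 2 * n * pi"
    by (simp add: complex_eq_iff)
  with I[OF assms(1)] I[OF assms(2)] have "\<bar>2 * real_of_int n * pi\<bar> < 2 * pi"
    by auto
  then have "\<bar>real_of_int n\<bar> < 1"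
    by (simp add: abs_mult)
  then have "n = 0"
    by linarith
  with n have "Im (lift s) = Im (lift t)"
    by simp
  then show ?thesis
    using strict_mono_on_imp_inj_on[OF strict_mono_Im_lift] assms by (auto dest!: inj_onD)
qed

text \<open>By the intermediate value theorem the argument of the curve attains that of
  \<open>z\<close>; a positive factor then adjusts the modulus.\<close>

lemma ray_meets_curve:
  assumes "z \<noteq> 0"
  obtains t r where "t \<in> {0..<T}" "0 < r" "z = r *\<^sub>R g t"
proof -
  \<comment> \<open>Dividing by \<open>g 0\<close> measures the argument from the direction of
    \<open>g 0\<close>, in accordance with \<open>lift 0 = 0\<close>.\<close>
  define \<rho> \<phi> where "\<rho> = norm (z / g 0)" and "\<phi> = Arg2pi (z / g 0)"
  have \<phi>: "0 \<le> \<phi>" "\<phi> < 2 * pi" "z / g 0 = of_real \<rho> * exp (\<i> * of_real \<phi>)"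
    using Arg2pi[of "z / g 0"] by (simp_all add: \<rho>_def \<phi>_def is_Arg_def)
  have "continuous_on {0..T} lift"
    using lift_deriv by (rule continuous_on_vector_derivative)
  then have "continuous_on {0..T} (\<lambda>t. Im (lift t))"
    by (intro continuous_intros)
  then obtain t where t: "0 \<le> t" "t \<le> T" "Im (lift t) = \<phi>"
    using IVT'[of "\<lambda>t. Im (lift t)" 0 \<phi> T] \<phi> period_pos Im_lift_T lift_0 by auto
  \<comment> \<open>At \<open>T\<close> the argument is \<open>2 * pi\<close>, which
    \<open>\<phi>\<close> does not reach.\<close>
  with \<phi> Im_lift_T have "t \<noteq> T"
    by auto
  with t have T: "t \<in> {0..<T}"
    by auto
  have "lift t = of_real (Re (lift t)) + \<i> * of_real \<phi>"
    using t by (simp add: complex_eq_iff)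
  then have "g t = g 0 * (of_real (exp (Re (lift t))) * exp (\<i> * of_real \<phi>))"
    using exp_lift[of t] T by (metis atLeastAtMost_iff atLeastLessThan_iff exp_add exp_of_real less_imp_le)
  moreover have "z = g 0 * (of_real \<rho> * exp (\<i> * of_real \<phi>))"
    using \<phi>(3) nonzero[of 0] by (simp add: \<rho>_def nonzero_divide_eq_eq mult.commute)
  ultimately have "z = (\<rho> / exp (Re (lift t))) *\<^sub>R g t"
    by (simp add: scaleR_conv_of_real)
  moreover have "0 < \<rho> / exp (Re (lift t))"
    using assms nonzero by (simp add: \<rho>_def)
  ultimately show thesis
    using T that by blast
qed

end

section \<open>The inside of a star-shaped curve\<close>

lemma bounded_continuous_image:
  fixes f :: "'a::heine_borel \<Rightarrow> 'b::metric_space"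
  assumes "continuous_on UNIV f" "bounded S"
  shows "bounded (f ` S)"
proof (rule bounded_subset)
  have "compact (closure S)"
    using assms by (simp add: compact_eq_bounded_closed bounded_closure)
  then show "bounded (f ` closure S)"
    using assms by (meson compact_continuous_image compact_imp_bounded continuous_on_subset subset_UNIV)
qed (simp add: closure_subset image_mono)

text \<open>The inverse carries the component of \<open>f x\<close> into the component of
  \<open>x\<close>, which is bounded. Mapping back by \<open>f\<close> preserves boundedness,
  because \<open>f\<close> is continuous on the whole space.\<close>

lemma inside_homeomorphism_subset:
  fixes f :: "'a::euclidean_space \<Rightarrow> 'b::euclidean_space"
  assumes "homeomorphism UNIV UNIV f g"
  shows "f ` inside S \<subseteq> inside (f ` S)"
proof
  fix y assume "y \<in> f ` inside S"
  then obtain x where x: "x \<in> inside S" "y = f x"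
    by blast
  have gf: "g (f z) = z" and fg: "f (g w) = w" for z w
    using assms by (auto simp: homeomorphism_def)
  have cont: "continuous_on A f" "continuous_on B g" for A B
    using assms by (auto simp: homeomorphism_def intro: continuous_on_subset)
  define C where "C = connected_component_set (- f ` S) y"
  have "y \<notin> f ` S"
    using x gf inside_no_overlap by (metis disjoint_iff imageE)
  then have "y \<in> C"
    by (simp add: C_def)
  have "g ` C \<subseteq> connected_component_set (- S) x"
  proof (rule connected_component_maximal)
    show "x \<in> g ` C"
      using \<open>y \<in> C\<close> x gf by (metis image_eqI)
    show "connected (g ` C)"
      by (simp add: C_def connected_continuous_image cont)
    have "C \<subseteq> - f ` S"
      unfolding C_def by (rule connected_component_subset)
    then show "g ` C \<subseteq> - S"
      using fg by (metis ComplD ComplI image_eqI image_subsetI subsetD)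
  qed
  moreover have "bounded (connected_component_set (- S) x)"
    using x by (simp add: inside_def)
  ultimately have "bounded (g ` C)"
    by (rule bounded_subset[rotated])
  from bounded_continuous_image[OF cont(1) this] have "bounded C"
    by (simp add: image_image fg)
  with \<open>y \<notin> f ` S\<close> show "y \<in> inside (f ` S)"
    by (simp add: inside_def C_def)
qed

text \<open>The inclusion is applied to \<open>f\<close> and to its inverse. The result transports
  the inside through the embedding into the complex plane and through translations.\<close>

lemma inside_homeomorphism:
  fixes f :: "'a::euclidean_space \<Rightarrow> 'b::euclidean_space"
  assumes "homeomorphism UNIV UNIV f g"
  shows "inside (f ` S) = f ` inside S"
proof (rule antisym)
  have "homeomorphism UNIV UNIV g f"
    using assms by (rule homeomorphism_symD)
  from inside_homeomorphism_subset[OF this, of "f ` S"]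
  have "g ` inside (f ` S) \<subseteq> inside S"
    using assms by (simp add: image_image homeomorphism_def)
  then have "f ` g ` inside (f ` S) \<subseteq> f ` inside S"
    by (rule image_mono)
  then show "inside (f ` S) \<subseteq> f ` inside S"
    using assms by (simp add: image_image homeomorphism_def)
qed (rule inside_homeomorphism_subset[OF assms])

section \<open>Plane curves that are star-shaped about the origin\<close>

definition cross :: "real^2 \<Rightarrow> real^2 \<Rightarrow> real" where
  "cross a b = a$1 * b$2 - a$2 * b$1"

lemma cross_eq_0_imp_parallel:
  assumes "cross a b = 0" "b \<noteq> 0"
  obtains s where "a = s *\<^sub>R b"
proof -
  \<comment> \<open>In general the two sides differ by \<open>cross a b\<close> times a quarter turn
    of \<open>b\<close>.\<close>
  have "(b \<bullet> b) *\<^sub>R a = (a \<bullet> b) *\<^sub>R b"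
    using assms(1) by (simp add: vec_eq_iff forall_2 inner_vec_def sum_2 cross_def algebra_simps)
  then have "inverse (b \<bullet> b) *\<^sub>R (b \<bullet> b) *\<^sub>R a = inverse (b \<bullet> b) *\<^sub>R (a \<bullet> b) *\<^sub>R b"
    by simp
  then have "a = (inverse (b \<bullet> b) * (a \<bullet> b)) *\<^sub>R b"
    using assms(2) by simp
  then show thesis ..
qed

text \<open>Here \<open>u\<close> is the curve seen from the base point, and
  \<open>cross_nonzero\<close> says that the tangent lines avoid the origin.\<close>

locale starlike_closed_curve =
  fixes u u' :: "real \<Rightarrow> real^2" and T :: real
  assumes period_pos: "0 < T"
    and periodic: "\<And>t. u (t + T) = u t"
    and deriv: "\<And>t. (u has_vector_derivative u' t) (at t)"
    and continuous_deriv: "continuous_on UNIV u'"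
    and inj: "inj_on u {0..<T}"
    and cross_nonzero: "\<And>t. cross (u t) (u' t) \<noteq> 0"
begin

lemma continuous: "continuous_on S u"
  by (rule continuous_on_vector_derivative[OF has_vector_derivative_at_within[OF deriv]])

lemma continuous_cross: "continuous_on S (\<lambda>t. cross (u t) (u' t))"
  unfolding cross_def
  by (intro continuous_intros continuous continuous_on_subset[OF continuous_deriv]) auto

lemma nonzero: "u t \<noteq> 0"
  using cross_nonzero[of t] by (auto simp: cross_def)

definition orientation :: real where
  "orientation = sgn (cross (u 0) (u' 0))"

lemma abs_orientation: "\<bar>orientation\<bar> = 1"
  using cross_nonzero by (simp add: orientation_def abs_sgn_eq)

lemma orientation_squared: "orientation * orientation = 1"
  using abs_orientation by (auto simp: abs_if split: if_splits)

text \<open>A continuous function without zeros keeps its sign on the line, so the sign at parameter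
  \<open>0\<close> decides.\<close>

lemma abs_cross: "\<bar>cross (u t) (u' t)\<bar> = orientation * cross (u t) (u' t)"
proof -
  let ?w = "\<lambda>t. cross (u t) (u' t)"
  have "connected (range ?w)"
    using continuous_cross by (intro connected_continuous_image) auto
  moreover have "0 \<notin> range ?w"
    using cross_nonzero by (auto dest: sym)
  ultimately have "\<not> (?w r < 0 \<and> 0 < ?w s)" for r s
    using connectedD_interval[of "range ?w" "?w r" "?w s" 0] by auto
  from this[of 0 t] this[of t 0] show ?thesis
    using cross_nonzero[of t] cross_nonzero[of 0]
    by (auto simp: orientation_def sgn_if)
qed

text \<open>A clockwise curve is reflected, so that its image in the complex plane turns left.\<close>

definition emb :: "real^2 \<Rightarrow> complex" where
  "emb v = Complex (v$1) (orientation * v$2)"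

lemma Re_emb [simp]: "Re (emb v) = v$1"
  and Im_emb [simp]: "Im (emb v) = orientation * v$2"
  by (simp_all add: emb_def)

lemma bounded_linear_emb: "bounded_linear emb"
proof -
  have "linear emb"
    by (rule linearI) (simp_all add: complex_eq_iff algebra_simps)
  then show ?thesis
    by (simp add: linear_conv_bounded_linear)
qed

lemma homeomorphism_emb:
  "homeomorphism UNIV UNIV emb (\<lambda>z. vector [Re z, orientation * Im z])"
proof -
  have lin: "linear (\<lambda>z. vector [Re z, orientation * Im z] :: real^2)"
    by (rule linearI) (simp_all add: vec_eq_iff forall_2 algebra_simps)
  have "emb (vector [Re z, orientation * Im z]) = z" for z
    by (simp add: complex_eq_iff mult.assoc[symmetric] orientation_squared)
  moreover have "vector [Re (emb v), orientation * Im (emb v)] = v" for v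
    by (simp add: vec_eq_iff forall_2 mult.assoc[symmetric] orientation_squared)
  ultimately show ?thesis
    by (intro homeomorphismI) (simp_all add: linear_continuous_on[OF bounded_linear_emb]
      linear_continuous_on[OF linear_conv_bounded_linear[THEN iffD1, OF lin]])
qed

lemma inj_emb: "emb v = emb w \<longleftrightarrow> v = w"
  using abs_orientation by (auto simp: complex_eq_iff vec_eq_iff forall_2)

lemma emb_scaleR: "emb (r *\<^sub>R v) = r *\<^sub>R emb v"
  by (simp add: complex_eq_iff)

sublocale emb: closed_curve_turning_left "\<lambda>t. emb (u t)" "\<lambda>t. emb (u' t)" T
proof
  show "((\<lambda>t. emb (u t)) has_vector_derivative emb (u' t)) (at t)" for t
    using bounded_linear.has_vector_derivative[OF bounded_linear_emb deriv] .
  show "continuous_on UNIV (\<lambda>t. emb (u' t))"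
    using bounded_linear.continuous_on[OF bounded_linear_emb continuous_deriv] .
  show "inj_on (\<lambda>t. emb (u t)) {0..<T}"
    using inj by (auto simp: inj_on_def inj_emb)
  show "0 < Im (emb (u' t) / emb (u t))" for t
  proof -
    have "emb (u t) \<noteq> 0"
      using nonzero[of t] inj_emb[of "u t" 0] by (simp add: emb_def zero_complex.code)
    then have "0 < (Re (emb (u t)))\<^sup>2 + (Im (emb (u t)))\<^sup>2"
      by (metis cmod_power2 zero_less_norm_iff zero_less_power)
    \<comment> \<open>This is \<open>orientation * cross (u t) (u' t)\<close>, the numerator of the
      imaginary part of the quotient.\<close>
    moreover have "0 < Re (emb (u t)) * Im (emb (u' t)) - Im (emb (u t)) * Re (emb (u' t))"
      using abs_cross[of t] cross_nonzero[of t] by (simp add: cross_def algebra_simps)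
    ultimately show ?thesis
      by (simp add: Im_divide algebra_simps)
  qed
qed (simp_all add: period_pos periodic)

lemma same_ray_imp_eq:
  assumes "s \<in> {0..<T}" "t \<in> {0..<T}" "0 < r" "u s = r *\<^sub>R u t"
  shows "s = t"
  using emb.same_ray_imp_eq[OF assms(1-3)] assms(4) by (simp add: emb_scaleR)

lemma ray_meets_curve:
  assumes "v \<noteq> 0"
  obtains t r where "t \<in> {0..<T}" "0 < r" "v = r *\<^sub>R u t"
proof -
  have "emb v \<noteq> 0"
    using assms inj_emb[of v 0] by (simp add: emb_def zero_complex.code)
  from emb.ray_meets_curve[OF this] show thesis
    using that by (metis emb_scaleR inj_emb)
qed

lemma zero_in_inside: "0 \<in> inside (range u)"
proof -
  have "range (\<lambda>t. emb (u t)) = emb ` range u"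
    by auto
  then have "0 \<in> emb ` inside (range u)"
    using emb.zero_in_inside inside_homeomorphism[OF homeomorphism_emb] by metis
  moreover have "emb 0 = 0"
    by (simp add: complex_eq_iff)
  ultimately show ?thesis
    using inj_emb by (metis imageE)
qed

text \<open>The curve has no point but \<open>u t\<close> on the ray through \<open>u t\<close>; the
  case \<open>r = 0\<close> holds as the curve avoids the origin.\<close>

lemma multiple_notin_range:
  assumes "t \<in> {0..<T}" "0 \<le> r" "r \<noteq> 1"
  shows "r *\<^sub>R u t \<notin> range u"
proof
  assume "r *\<^sub>R u t \<in> range u"
  then obtain s where s: "s \<in> {0..<T}" "u s = r *\<^sub>R u t"
    using periodic_range[OF period_pos, of u] periodic by (metis imageE)
  with nonzero[of s] assms have "0 < r"
    by (cases "r = 0") auto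
  from same_ray_imp_eq[OF s(1) assms(1) this s(2)] s(2) nonzero[of t] assms(3) show False
    by (metis scaleR_one scaleR_right_imp_eq)
qed

text \<open>A point below the curve on its ray is joined to the origin by a segment that misses the
  curve. A point beyond the curve is the start of an unbounded half-line that misses it, so its
  component is unbounded.\<close>

lemma inside_range:
  "inside (range u) = (\<lambda>(r, t). r *\<^sub>R u t) ` ({0..<1} \<times> {0..<T})"
proof (intro antisym subsetI)
  fix v assume "v \<in> (\<lambda>(r, t). r *\<^sub>R u t) ` ({0..<1} \<times> {0..<T})"
  then obtain r t where v: "v = r *\<^sub>R u t" and r: "0 \<le> r" "r < 1" and t: "t \<in> {0..<T}"
    by auto
  let ?I = "(\<lambda>s. s *\<^sub>R u t) ` {0..r}"
  have "connected ?I"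
    by (intro connected_continuous_image continuous_intros) auto
  moreover have "?I \<subseteq> - range u"
  proof (intro image_subsetI ComplI)
    fix s assume "s \<in> {0..r}" "s *\<^sub>R u t \<in> range u"
    then show False
      using multiple_notin_range[OF t, of s] r by simp
  qed
  moreover have "0 \<in> ?I"
    by (rule image_eqI[of _ _ 0]) (use r in auto)
  moreover have "v \<in> ?I"
    by (rule image_eqI[of _ _ r]) (use r v in auto)
  ultimately have "connected_component (- range u) 0 v"
    unfolding connected_component_def by (intro exI[of _ ?I]) simp
  then show "v \<in> inside (range u)"
    using inside_same_component zero_in_inside by blast
next
  fix v assume v: "v \<in> inside (range u)"
  show "v \<in> (\<lambda>(r, t). r *\<^sub>R u t) ` ({0..<1} \<times> {0..<T})"
  proof (cases "v = 0")
    case True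
    then show ?thesis
      using period_pos by (intro image_eqI[of _ _ "(0, 0)"]) auto
  next
    case False
    then obtain t r where t: "t \<in> {0..<T}" and r: "0 < r" and vr: "v = r *\<^sub>R u t"
      using ray_meets_curve by blast
    have "r < 1"
    proof (rule ccontr)
      assume "\<not> r < 1"
      moreover have "r \<noteq> 1"
        using v vr by (auto simp: inside_def)
      ultimately have "1 < r"
        by simp
      \<comment> \<open>The half-line from \<open>v\<close> away from the origin.\<close>
      let ?I = "(\<lambda>s. s *\<^sub>R u t) ` {r..}"
      have "?I \<subseteq> connected_component_set (- range u) v"
      proof (rule connected_component_maximal)
        show "connected ?I"
          by (intro connected_continuous_image continuous_intros) auto
        show "?I \<subseteq> - range u"
        proof (intro image_subsetI ComplI)
          fix s assume "s \<in> {r..}" "s *\<^sub>R u t \<in> range u"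
          then show False
            using multiple_notin_range[OF t, of s] \<open>1 < r\<close> by simp
        qed
      qed (auto simp: vr)
      moreover have "bounded (connected_component_set (- range u) v)"
        using v by (simp add: inside_def)
      ultimately have "bounded ?I"
        by (rule bounded_subset[rotated])
      then obtain B where "\<forall>x\<in>?I. norm x \<le> B"
        unfolding bounded_iff by blast
      then have B: "norm (s *\<^sub>R u t) \<le> B" if "r \<le> s" for s
        using that by blast
      \<comment> \<open>The second entry pushes the norm beyond \<open>B\<close>; the maximum with
        \<open>r\<close> keeps the point on the half-line.\<close>
      define s where "s = max r ((\<bar>B\<bar> + 1) / norm (u t))"
      have "\<bar>B\<bar> + 1 = (\<bar>B\<bar> + 1) / norm (u t) * norm (u t)"
        using nonzero[of t] by simp
      also have "\<dots> \<le> s * norm (u t)"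
        by (intro mult_right_mono) (simp_all add: s_def)
      also have "\<dots> = norm (s *\<^sub>R u t)"
        using r by (simp add: s_def)
      also have "\<dots> \<le> B"
        by (rule B) (simp add: s_def)
      finally show False
        by simp
    qed
    then show ?thesis
      using t r vr by (intro image_eqI[of _ _ "(r, t)"]) auto
  qed
qed

end

section \<open>Integration in polar form\<close>

lemma negligible_component: "negligible {v::real^'n. v$k = c}"
  using negligible_standard_hyperplane[of "axis k (1::real)"] by (simp add: cart_eq_inner_axis)

text \<open>Fubini's theorem on \<open>real \<times> real\<close>, transported along the
  volume-preserving identification \<open>h\<close> with inverse \<open>g\<close>.\<close>

lemma integral_cbox_cart_2:
  fixes f :: "real^2 \<Rightarrow> 'c::banach"
  assumes "continuous_on UNIV f"
  shows "integral (cbox (vector [a, c]) (vector [b, d])) f =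
    integral {a..b} (\<lambda>x. integral {c..d} (\<lambda>y. f (vector [x, y])))"
proof -
  define h :: "real \<times> real \<Rightarrow> real^2" where "h z = vector [fst z, snd z]" for z
  define g :: "real^2 \<Rightarrow> real \<times> real" where "g v = (v$1, v$2)" for v
  have hg: "h (g v) = v" and gh: "g (h z) = z" for v z
    by (simp_all add: h_def g_def vec_eq_iff forall_2)
  have "linear h"
    by (rule linearI) (simp_all add: h_def vec_eq_iff forall_2)
  then have "continuous_on UNIV h"
    by (simp add: linear_continuous_on linear_conv_bounded_linear)
  then have cont: "continuous_on UNIV (\<lambda>z. f (h z))"
    by (rule continuous_on_compose2[OF assms]) auto
  have g_cbox: "g ` cbox v w = cbox (v$1, v$2) (w$1, w$2)" for v w
  proof -
    have mem: "g x \<in> cbox (v$1, v$2) (w$1, w$2) \<longleftrightarrow> x \<in> cbox v w" for x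
      by (auto simp: g_def mem_box_cart forall_2 cbox_Pair_eq)
    show ?thesis
    proof (intro antisym subsetI)
      fix z assume "z \<in> cbox (v$1, v$2) (w$1, w$2)"
      then have "h z \<in> cbox v w"
        using mem[of "h z"] by (simp add: gh)
      then show "z \<in> g ` cbox v w"
        using gh by (metis image_eqI)
    qed (use mem in blast)
  qed
  have h_cbox: "h ` cbox z y = cbox (h z) (h y)" for z y
  proof -
    have "cbox z y = g ` cbox (h z) (h y)"
      using g_cbox[of "h z" "h y"] by (simp add: h_def)
    then show ?thesis
      by (simp only: image_image hg image_ident)
  qed
  have ne: "cbox v w = {} \<longleftrightarrow> \<not> (v$1 \<le> w$1 \<and> v$2 \<le> w$2)" for v w :: "real^2"
    using interval_ne_empty_cart(1)[of v w] unfolding forall_2 by blast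
  let ?i = "integral (cbox (a, c) (b, d)) (\<lambda>z. f (h z))"
  have "((\<lambda>v. f (h (g v))) has_integral (1 / 1) *\<^sub>R ?i) (h ` cbox (a, c) (b, d))"
  proof (rule has_integral_twiddle)
    show "measure lborel (g ` cbox v w) = 1 * measure lborel (cbox v w)" for v w
      by (simp add: g_cbox content_Pair content_cbox_if_cart prod_2 UNIV_2 ne)
    show "continuous (at v) g" for v
      unfolding g_def by (intro continuous_intros)
    show "((\<lambda>z. f (h z)) has_integral ?i) (cbox (a, c) (b, d))"
      by (intro integrable_integral integrable_continuous continuous_on_subset[OF cont]) auto
  qed (use g_cbox h_cbox gh hg in auto)
  then have "integral (cbox (h (a, c)) (h (b, d))) f = ?i"
    by (simp add: hg h_cbox integral_unique)
  also have "?i = integral {a..b} (\<lambda>x. integral {c..d} (\<lambda>y. f (h (x, y))))"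
    using integral_prod_continuous[OF continuous_on_subset[OF cont]] by simp
  finally show ?thesis
    by (simp add: h_def)
qed

context starlike_closed_curve
begin

section \<open>Coordinates given by the fraction along a ray and the curve parameter\<close>

definition cone_map :: "real^2 \<Rightarrow> real^2 \<Rightarrow> real^2" where
  "cone_map p v = p + v$1 *\<^sub>R u (v$2)"

definition cone_map_deriv :: "real^2 \<Rightarrow> real^2 \<Rightarrow> real^2" where
  "cone_map_deriv v h = h$1 *\<^sub>R u (v$2) + (v$1 * h$2) *\<^sub>R u' (v$2)"

text \<open>Fraction \<open>0\<close> is left out because \<open>cone_map p\<close> collapses it to
  \<open>p\<close>, and the parameter runs over a half-open period; both serve injectivity.\<close>

definition strip :: "(real^2) set" where
  "strip = {v. 0 < v$1 \<and> v$1 < 1 \<and> 0 \<le> v$2 \<and> v$2 < T}"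

lemma cone_map_has_derivative: "(cone_map p has_derivative cone_map_deriv v) (at v within S)"
proof -
  have "((\<lambda>v. u (v$2)) has_derivative (\<lambda>h. h$2 *\<^sub>R u' (v$2))) (at v within S)"
    using has_derivative_compose[OF bounded_linear_imp_has_derivative[OF bounded_linear_vec_nth]
        deriv[unfolded has_vector_derivative_def]] .
  moreover have "((\<lambda>v. v$1) has_derivative (\<lambda>h. h$1)) (at v within S)"
    by (rule bounded_linear_imp_has_derivative[OF bounded_linear_vec_nth])
  ultimately have "((\<lambda>v. v$1 *\<^sub>R u (v$2)) has_derivative
      (\<lambda>h. v$1 *\<^sub>R (h$2 *\<^sub>R u' (v$2)) + h$1 *\<^sub>R u (v$2))) (at v within S)"
    by (rule has_derivative_scaleR[rotated])
  then have "((\<lambda>v. p + v$1 *\<^sub>R u (v$2)) has_derivative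
      (\<lambda>h. v$1 *\<^sub>R (h$2 *\<^sub>R u' (v$2)) + h$1 *\<^sub>R u (v$2))) (at v within S)"
    by (simp add: has_derivative_add_const add.commute[of p])
  then show ?thesis
    by (simp add: cone_map_def[abs_def] cone_map_deriv_def[abs_def] add.commute)
qed

lemma det_cone_map_deriv: "det (matrix (cone_map_deriv v)) = v$1 * cross (u (v$2)) (u' (v$2))"
  by (simp add: det_2 matrix_def cone_map_deriv_def cross_def axis_def algebra_simps)

lemma strip_lebesgue: "strip \<in> sets lebesgue"
proof -
  have "strip = {v. 0 < v$1} \<inter> {v. v$1 < 1} \<inter> {v. 0 \<le> v$2} \<inter> {v. v$2 < T}"
    by (auto simp: strip_def)
  moreover have "open {v::real^2. 0 < v$1}" "open {v::real^2. v$1 < 1}"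
    "closed {v::real^2. 0 \<le> v$2}" "open {v::real^2. v$2 < T}"
    by (intro open_Collect_less closed_Collect_le continuous_intros)+
  ultimately have "strip \<in> sets borel"
    by (auto intro!: sets.Int borel_open borel_closed)
  then show ?thesis
    by (simp add: sets_completionI_sets)
qed

lemma negligible_cbox_minus_strip: "negligible (cbox (vector [0, 0]) (vector [1, T]) - strip)"
proof (rule negligible_subset)
  show "negligible ({v. v$1 = 0} \<union> {v. v$1 = 1} \<union> {v::real^2. v$2 = T})"
    by (intro negligible_Un negligible_component)
qed (auto simp: strip_def mem_box_cart forall_2)

lemma strip_subset: "strip \<subseteq> cbox (vector [0, 0]) (vector [1, T])"
  by (auto simp: strip_def mem_box_cart forall_2)

text \<open>Dividing by the positive first coordinate puts the two curve points on one ray, so the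
  parameters agree; the nonzero vector \<open>u (v$2)\<close> then determines the fraction.\<close>

lemma inj_on_cone_map: "inj_on (cone_map p) strip"
proof (rule inj_onI)
  fix v w assume vw: "v \<in> strip" "w \<in> strip" "cone_map p v = cone_map p w"
  then have pos: "0 < v$1" "0 < w$1"
    by (auto simp: strip_def)
  have eq: "v$1 *\<^sub>R u (v$2) = w$1 *\<^sub>R u (w$2)"
    using vw by (simp add: cone_map_def)
  then have "inverse (v$1) *\<^sub>R v$1 *\<^sub>R u (v$2) = inverse (v$1) *\<^sub>R w$1 *\<^sub>R u (w$2)"
    by (rule arg_cong)
  then have "u (v$2) = (inverse (v$1) * w$1) *\<^sub>R u (w$2)"
    using pos by simp
  moreover have "0 < inverse (v$1) * w$1"
    using pos by simp
  ultimately have "v$2 = w$2"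
    using vw same_ray_imp_eq[of "v$2" "w$2" "inverse (v$1) * w$1"] by (auto simp: strip_def)
  with eq nonzero show "v = w"
    by (simp add: vec_eq_iff[of v] forall_2)
qed

lemma inside_translated_range:
  "inside (range (\<lambda>t. p + u t)) = insert p (cone_map p ` strip)"
proof -
  have "homeomorphism UNIV UNIV ((+) p) ((+) (- p))"
    by (intro homeomorphismI continuous_intros) auto
  from inside_homeomorphism[OF this, of "range u"]
  have "inside (range (\<lambda>t. p + u t)) = (+) p ` inside (range u)"
    by (simp add: image_image)
  also have "\<dots> = insert p (cone_map p ` strip)"
  proof (intro antisym subsetI)
    fix x assume "x \<in> (+) p ` inside (range u)"
    then obtain r t where x: "x = p + r *\<^sub>R u t" "0 \<le> r" "r < 1" "t \<in> {0..<T}"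
      unfolding inside_range by auto
    show "x \<in> insert p (cone_map p ` strip)"
    proof (cases "r = 0")
      case False
      then have "x \<in> cone_map p ` strip"
        using x by (intro image_eqI[of _ _ "vector [r, t]"]) (auto simp: cone_map_def strip_def)
      then show ?thesis
        by simp
    qed (use x in simp)
  next
    fix x assume "x \<in> insert p (cone_map p ` strip)"
    then show "x \<in> (+) p ` inside (range u)"
    proof
      assume "x = p"
      then show ?thesis
        using zero_in_inside by (intro image_eqI[of _ _ 0]) auto
    next
      assume "x \<in> cone_map p ` strip"
      then obtain v where v: "x = cone_map p v" "v \<in> strip" ..
      then have "v$1 *\<^sub>R u (v$2) \<in> inside (range u)"
        unfolding inside_range by (intro image_eqI[of _ _ "(v$1, v$2)"]) (auto simp: strip_def)
      with v show ?thesis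
        by (auto simp: cone_map_def)
    qed
  qed
  finally show ?thesis .
qed

lemma continuous_component: "continuous_on UNIV (\<lambda>v::real^2. u (v$2))"
  "continuous_on UNIV (\<lambda>v::real^2. cross (u (v$2)) (u' (v$2)))"
  using continuous_on_compose2[OF continuous[of UNIV], of UNIV "\<lambda>v. v$2"]
    continuous_on_compose2[OF continuous_cross[of UNIV], of UNIV "\<lambda>v. v$2"]
  by (simp_all add: continuous_on_component)

text \<open>Change of variables along \<open>cone_map p\<close>. On the strip the absolute value of
  the Jacobian is \<open>orientation\<close> times the Jacobian, so a constant sign comes out and a
  continuous integrand on a box remains.\<close>

lemma integral_inside_range:
  fixes f :: "real^2 \<Rightarrow> real^'n"
  assumes "continuous_on UNIV f"
  shows "integral (inside (range (\<lambda>t. p + u t))) f = orientation *\<^sub>R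
      integral {0..1} (\<lambda>r. integral {0..T} (\<lambda>t. (r * cross (u t) (u' t)) *\<^sub>R f (p + r *\<^sub>R u t)))"
    (is "integral ?D f = _")
proof -
  define F where "F v = (v$1 * cross (u (v$2)) (u' (v$2))) *\<^sub>R f (p + v$1 *\<^sub>R u (v$2))" for v :: "real^2"
  let ?box = "cbox (vector [0, 0]) (vector [1, T]) :: (real^2) set"
  let ?G = "\<lambda>v. \<bar>det (matrix (cone_map_deriv v))\<bar> *\<^sub>R f (cone_map p v)"
  have contF: "continuous_on UNIV F"
    unfolding F_def
    by (intro continuous_intros continuous_component continuous_on_compose2[OF assms]) auto
  have G: "?G v = orientation *\<^sub>R F v" if "v \<in> strip" for v
    using that by (simp add: F_def det_cone_map_deriv cone_map_def abs_mult abs_cross strip_def mult.left_commute)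
  have "F absolutely_integrable_on ?box"
    by (intro absolutely_integrable_continuous continuous_on_subset[OF contF]) auto
  then have "F absolutely_integrable_on strip"
    using strip_lebesgue strip_subset by (rule set_integrable_subset)
  then have "(\<lambda>v. orientation *\<^sub>R F v) absolutely_integrable_on strip"
    by (rule absolutely_integrable_scaleR_left)
  then have "?G absolutely_integrable_on strip"
    using G by (metis (no_types, lifting) set_integrable_cong)
  moreover have "integral strip ?G = orientation *\<^sub>R integral ?box F"
  proof -
    have "integral strip ?G = integral strip (\<lambda>v. orientation *\<^sub>R F v)"
      by (rule integral_cong) (rule G)
    also have "\<dots> = orientation *\<^sub>R integral ?box F"
      by (simp add: integral_subset_negligible[OF strip_subset negligible_cbox_minus_strip])
    finally show ?thesis .
  qed
  ultimately have "integral (cone_map p ` strip) f = orientation *\<^sub>R integral ?box F"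
    using has_absolute_integral_change_of_variables[OF strip_lebesgue cone_map_has_derivative inj_on_cone_map,
        where f = f and b = "orientation *\<^sub>R integral ?box F" and p1 = p] by auto
  \<comment> \<open>The only point missed is \<open>p\<close>.\<close>
  moreover have "cone_map p ` strip \<subseteq> ?D" "negligible (?D - cone_map p ` strip)"
    by (auto simp: inside_translated_range intro: negligible_subset[of "{p}"])
  ultimately show ?thesis
    using integral_subset_negligible[of "cone_map p ` strip" ?D f] integral_cbox_cart_2[OF contF, of 0 0 1 T]
    by (simp add: F_def)
qed

end

section \<open>The limiting circumcenter\<close>

lemma tendsto_difference_quotient:
  assumes "(f has_vector_derivative D) (at x)"
  shows "(\<lambda>h. (f (x + h) - f x) /\<^sub>R h) \<midarrow>0\<rightarrow> D"
proof -
  have lim: "(\<lambda>h. norm (f (x + h) - f x - h *\<^sub>R D) / norm h) \<midarrow>0\<rightarrow> 0"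
    using assms by (simp add: has_vector_derivative_def has_derivative_at)
  have "norm (f (x + h) - f x - h *\<^sub>R D) / norm h = norm ((f (x + h) - f x) /\<^sub>R h - D)"
    if "h \<noteq> 0" for h
  proof -
    have "(f (x + h) - f x) /\<^sub>R h - D = (f (x + h) - f x - h *\<^sub>R D) /\<^sub>R h"
      using that by (simp add: scaleR_diff_right)
    then show ?thesis
      by (simp add: divide_inverse mult.commute)
  qed
  then have "(\<lambda>h. norm ((f (x + h) - f x) /\<^sub>R h - D)) \<midarrow>0\<rightarrow> 0"
    using lim by (subst (asm) LIM_equal) auto
  then show ?thesis
    by (rule LIM_zero_cancel[OF tendsto_norm_zero_cancel])
qed

section \<open>Clockwise quarter turns and the circumcenter as the solution of a linear
  system\<close>

definition rot :: "real^2 \<Rightarrow> real^2" where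
  "rot a = vector [a$2, - a$1]"

lemma rot_nth [simp]: "rot a $ 1 = a$2" "rot a $ 2 = - a$1"
  by (simp_all add: rot_def)

lemma bounded_linear_rot: "bounded_linear rot"
proof -
  have "linear rot"
    by (rule linearI) (simp_all add: vec_eq_iff forall_2)
  then show ?thesis
    by (simp add: linear_conv_bounded_linear)
qed

lemma rot_scaleR: "rot (r *\<^sub>R a) = r *\<^sub>R rot a"
  by (simp add: vec_eq_iff forall_2)

lemma inner_real_2: "a \<bullet> b = a$1 * b$1 + a$2 * b$2" for a b :: "real^2"
  by (simp add: inner_vec_def sum_2)

lemma inner_rot: "rot a \<bullet> b = cross b a"
  by (simp add: inner_real_2 cross_def algebra_simps)

text \<open>Cramer's rule: it recovers \<open>d\<close> from its inner products with two independent
  vectors.\<close>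

lemma cross_scaleR_eq_rot: "cross a b *\<^sub>R d = rot ((d \<bullet> a) *\<^sub>R b - (d \<bullet> b) *\<^sub>R a)"
  by (simp add: vec_eq_iff forall_2 inner_real_2 cross_def algebra_simps)

text \<open>The perpendicular bisector of \<open>a\<close> and \<open>b\<close> becomes a linear
  equation for \<open>x - a\<close>.\<close>

lemma dist_eq_iff_inner:
  fixes x a b :: "'a::real_inner"
  shows "dist x a = dist x b \<longleftrightarrow> (x - a) \<bullet> (b - a) = (b - a) \<bullet> (b - a) / 2"
proof -
  have "dist x a = dist x b \<longleftrightarrow> (x - a) \<bullet> (x - a) = (x - b) \<bullet> (x - b)"
    by (simp add: dist_norm norm_eq)
  also have "x - b = (x - a) - (b - a)"
    by simp
  also have "(x - a) \<bullet> (x - a) = ((x - a) - (b - a)) \<bullet> ((x - a) - (b - a)) \<longleftrightarrow>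
      (x - a) \<bullet> (b - a) = (b - a) \<bullet> (b - a) / 2"
    unfolding inner_diff_left[of "x - a" "b - a"] inner_diff_right[of _ "x - a" "b - a"]
      inner_commute[of "b - a" "x - a"] by argo
  finally show ?thesis .
qed

text \<open>The bisector equations for the two sides at \<open>p\<close> form a linear system with
  determinant \<open>cross v w\<close>, whose unique solution Cramer's rule gives.\<close>

lemma circumcenter_eq:
  assumes "cross v w \<noteq> 0"
  shows "circumcenter p (p + v) (p + w) =
    p + (1 / (2 * cross v w)) *\<^sub>R rot ((v \<bullet> v) *\<^sub>R w - (w \<bullet> w) *\<^sub>R v)"
    (is "_ = p + ?d")
proof -
  have eq: "dist x p = dist x (p + v) \<and> dist x p = dist x (p + w) \<longleftrightarrow>
      (x - p) \<bullet> v = v \<bullet> v / 2 \<and> (x - p) \<bullet> w = w \<bullet> w / 2" for x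
    by (simp add: dist_eq_iff_inner)
  show ?thesis
    unfolding circumcenter_def eq
  proof (rule the_equality)
    have "cross v ((v \<bullet> v) *\<^sub>R w - (w \<bullet> w) *\<^sub>R v) = (v \<bullet> v) * cross v w"
      "cross w ((v \<bullet> v) *\<^sub>R w - (w \<bullet> w) *\<^sub>R v) = (w \<bullet> w) * cross v w"
      by (simp_all add: cross_def algebra_simps)
    then show "(p + ?d - p) \<bullet> v = v \<bullet> v / 2 \<and> (p + ?d - p) \<bullet> w = w \<bullet> w / 2"
      using assms by (simp add: inner_rot)
  next
    fix x assume x: "(x - p) \<bullet> v = v \<bullet> v / 2 \<and> (x - p) \<bullet> w = w \<bullet> w / 2"
    have "x - p = (1 / cross v w) *\<^sub>R cross v w *\<^sub>R (x - p)"
      using assms by simp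
    also have "\<dots> = (1 / cross v w) *\<^sub>R rot ((v \<bullet> v / 2) *\<^sub>R w - (w \<bullet> w / 2) *\<^sub>R v)"
      by (simp only: cross_scaleR_eq_rot x[THEN conjunct1] x[THEN conjunct2])
    also have "(v \<bullet> v / 2) *\<^sub>R w - (w \<bullet> w / 2) *\<^sub>R v = (1 / 2) *\<^sub>R ((v \<bullet> v) *\<^sub>R w - (w \<bullet> w) *\<^sub>R v)"
      by (simp add: scaleR_diff_right)
    finally have "x - p = ?d"
      by (simp add: rot_scaleR)
    then show "x = p + ?d"
      by (simp add: algebra_simps)
  qed
qed

context starlike_closed_curve
begin

text \<open>Writing \<open>u (t + h)\<close> as \<open>u t\<close> plus \<open>h\<close> times a
  difference quotient produces a factor \<open>h\<close> in numerator and denominator; after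
  cancelling it the limit can be taken termwise.\<close>

lemma limit_circumcenter_eq:
  "limit_circumcenter p (\<lambda>t. p + u t) t =
    (1 / (2 * cross (u t) (u' t))) *\<^sub>R rot ((u t \<bullet> u t) *\<^sub>R u' t - (2 * (u t \<bullet> u' t)) *\<^sub>R u t)"
  (is "_ = ?L")
  unfolding limit_circumcenter_def
proof (rule tendsto_Lim)
  define \<Delta> where "\<Delta> h = (u (t + h) - u t) /\<^sub>R h" for h
  have \<Delta>: "\<Delta> \<midarrow>0\<rightarrow> u' t"
    unfolding \<Delta>_def[abs_def] by (rule tendsto_difference_quotient[OF deriv])
  have u: "(\<lambda>h. u (t + h)) \<midarrow>0\<rightarrow> u t"
    using has_vector_derivative_continuous[OF deriv, of t] by (simp add: isCont_def LIM_offset_zero_iff)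
  have cross: "(\<lambda>h. cross (u t) (\<Delta> h)) \<midarrow>0\<rightarrow> cross (u t) (u' t)"
    unfolding cross_def by (intro tendsto_intros \<Delta>)
  have ev: "eventually (\<lambda>h. cross (u t) (\<Delta> h) \<noteq> 0 \<and> h \<noteq> 0) (at 0)"
    using tendsto_imp_eventually_ne[OF cross cross_nonzero] eventually_neq_at_within[of 0]
    by (rule eventually_conj)
  \<comment> \<open>The circumcenter formula with \<open>h\<close> cancelled.\<close>
  let ?f = "\<lambda>h. (1 / (2 * cross (u t) (\<Delta> h))) *\<^sub>R
      rot ((u t \<bullet> u t) *\<^sub>R \<Delta> h - ((u t + u (t + h)) \<bullet> \<Delta> h) *\<^sub>R u t)"
  have "?f \<midarrow>0\<rightarrow> (1 / (2 * cross (u t) (u' t))) *\<^sub>R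
      rot ((u t \<bullet> u t) *\<^sub>R u' t - ((u t + u t) \<bullet> u' t) *\<^sub>R u t)"
    using cross_nonzero[of t]
    by (intro tendsto_intros bounded_linear.tendsto[OF bounded_linear_rot] cross \<Delta> u) auto
  also have "(u t + u t) \<bullet> u' t = 2 * (u t \<bullet> u' t)"
    by (simp only: inner_add_left mult_2)
  finally show "((\<lambda>h. circumcenter p (p + u t) (p + u (t + h)) - p) \<longlongrightarrow> ?L) (at 0)"
  proof (rule Lim_transform_eventually)
    show "\<forall>\<^sub>F h in at 0. ?f h = circumcenter p (p + u t) (p + u (t + h)) - p"
      using ev
    proof eventually_elim
      case (elim h)
      have u_h: "u (t + h) = u t + h *\<^sub>R \<Delta> h"
        using elim by (simp add: \<Delta>_def)
      have cross_h: "cross (u t) (u (t + h)) = h * cross (u t) (\<Delta> h)"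
        unfolding u_h by (simp add: cross_def algebra_simps)
      \<comment> \<open>The squared norm changes from \<open>u t\<close> to \<open>u (t + h)\<close>
        by \<open>h * ((u t + u (t + h)) \<bullet> \<Delta> h)\<close>.\<close>
      have "(u t \<bullet> u t) *\<^sub>R u (t + h) - (u (t + h) \<bullet> u (t + h)) *\<^sub>R u t =
          h *\<^sub>R ((u t \<bullet> u t) *\<^sub>R \<Delta> h - ((u t + u (t + h)) \<bullet> \<Delta> h) *\<^sub>R u t)"
        unfolding u_h by (simp add: vec_eq_iff forall_2 inner_real_2 algebra_simps)
      then show ?case
        using elim by (simp add: circumcenter_eq cross_h rot_scaleR)
    qed
  qed
qed simp

text \<open>The integrand is the area density times the limiting circumcenter: the factors
  \<open>cross / 2\<close> and \<open>1 / (2 * cross)\<close> leave \<open>1 / 4\<close>. It differs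
  from a third of \<open>cross (u t) (u' t) *\<^sub>R u t\<close> by the derivative of a periodic
  function.\<close>

lemma has_integral_circumcenter:
  "((\<lambda>t. (1 / 4) *\<^sub>R rot ((u t \<bullet> u t) *\<^sub>R u' t - (2 * (u t \<bullet> u' t)) *\<^sub>R u t)) has_integral
    (1 / 3) *\<^sub>R integral {0..T} (\<lambda>t. cross (u t) (u' t) *\<^sub>R u t)) {0..T}"
proof -
  \<comment> \<open>The derivative of \<open>K\<close> is the difference of the two integrands.\<close>
  define K where "K t = (- 1 / 12) *\<^sub>R rot ((u t \<bullet> u t) *\<^sub>R u t)" for t
  let ?K' = "\<lambda>t. (- 1 / 12) *\<^sub>R rot ((u t \<bullet> u t) *\<^sub>R u' t + (u t \<bullet> u' t + u' t \<bullet> u t) *\<^sub>R u t)"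
  have "(K has_vector_derivative ?K' t) (at t within {0..T})" for t
  proof -
    have d: "(u has_vector_derivative u' t) (at t within {0..T})"
      by (rule has_vector_derivative_at_within[OF deriv])
    have "((\<lambda>t. u t \<bullet> u t) has_vector_derivative (u t \<bullet> u' t + u' t \<bullet> u t)) (at t within {0..T})"
      by (rule bounded_bilinear.has_vector_derivative[OF bounded_bilinear_inner d d])
    from bounded_bilinear.has_vector_derivative[OF bounded_bilinear_scaleR this d]
    have "((\<lambda>t. (u t \<bullet> u t) *\<^sub>R u t) has_vector_derivative
        (u t \<bullet> u t) *\<^sub>R u' t + (u t \<bullet> u' t + u' t \<bullet> u t) *\<^sub>R u t) (at t within {0..T})" .
    from bounded_linear.has_vector_derivative[OF bounded_linear_rot this]
    show ?thesis
      unfolding K_def by (rule bounded_linear.has_vector_derivative[OF bounded_linear_scaleR_right])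
  qed
  then have "(?K' has_integral K T - K 0) {0..T}"
    using period_pos by (intro fundamental_theorem_of_calculus) auto
  then have 1: "(?K' has_integral 0) {0..T}"
    using periodic[of 0] by (simp add: K_def)
  have "continuous_on {0..T} (\<lambda>t. cross (u t) (u' t) *\<^sub>R u t)"
    by (intro continuous_intros continuous_cross continuous)
  then have "((\<lambda>t. cross (u t) (u' t) *\<^sub>R u t) has_integral
      integral {0..T} (\<lambda>t. cross (u t) (u' t) *\<^sub>R u t)) {0..T}"
    by (intro integrable_integral integrable_continuous_real)
  from has_integral_add[OF has_integral_cmul[OF this, of "1 / 3"] 1]
  have "((\<lambda>t. (1 / 3) *\<^sub>R cross (u t) (u' t) *\<^sub>R u t + ?K' t) has_integral
      (1 / 3) *\<^sub>R integral {0..T} (\<lambda>t. cross (u t) (u' t) *\<^sub>R u t)) {0..T}"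
    by simp
  \<comment> \<open>By \<open>cross_scaleR_eq_rot\<close> with \<open>d = u t\<close>, the
    coefficient of \<open>u' t\<close> under \<open>rot\<close> is \<open>1/3 - 1/12 = 1/4\<close>
    times the squared norm, and that of \<open>u t\<close> is \<open>- (1/3 + 1/6) = - 1/2\<close>
    times the inner product.\<close>
  moreover have "(1 / 3) *\<^sub>R cross (u t) (u' t) *\<^sub>R u t + ?K' t =
      (1 / 4) *\<^sub>R rot ((u t \<bullet> u t) *\<^sub>R u' t - (2 * (u t \<bullet> u' t)) *\<^sub>R u t)" for t
    by (simp add: vec_eq_iff forall_2 inner_real_2 cross_def field_simps)
  ultimately show ?thesis
    by simp
qed

section \<open>Area and first moment as integrals along the curve\<close>

lemma area_density_eq:
  "area_density p (\<lambda>t. p + u t) t = cross (u t) (u' t) / 2"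
proof -
  have "((\<lambda>t. p + u t) has_vector_derivative u' t) (at t)"
    using has_vector_derivative_add[OF has_vector_derivative_const deriv] by simp
  then show ?thesis
    by (simp add: area_density_def vector_derivative_at det_2 cross_def)
qed

lemma CCM_eq:
  "CCM p T (\<lambda>t. p + u t) =
    ((1 / 3) *\<^sub>R integral {0..T} (\<lambda>t. cross (u t) (u' t) *\<^sub>R u t)) /\<^sub>R
    (integral {0..T} (\<lambda>t. cross (u t) (u' t)) / 2)"
proof -
  have "area_density p (\<lambda>t. p + u t) t *\<^sub>R limit_circumcenter p (\<lambda>t. p + u t) t =
      (1 / 4) *\<^sub>R rot ((u t \<bullet> u t) *\<^sub>R u' t - (2 * (u t \<bullet> u' t)) *\<^sub>R u t)" for t
    using cross_nonzero[of t] by (simp add: area_density_eq limit_circumcenter_eq)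
  then have "integral {0..T} (\<lambda>t. area_density p (\<lambda>t. p + u t) t *\<^sub>R limit_circumcenter p (\<lambda>t. p + u t) t) =
      (1 / 3) *\<^sub>R integral {0..T} (\<lambda>t. cross (u t) (u' t) *\<^sub>R u t)"
    using integral_unique[OF has_integral_circumcenter] by (simp only:)
  moreover have "integral {0..T} (area_density p (\<lambda>t. p + u t)) = integral {0..T} (\<lambda>t. cross (u t) (u' t)) / 2"
    by (simp add: area_density_eq[abs_def])
  ultimately show ?thesis
    by (simp only: CCM_def)
qed

text \<open>One formula for two uses: \<open>k = 0\<close> gives the area, \<open>c = p\<close> and
  \<open>k = 1\<close> give the first moment. The factors \<open>1/2\<close> and \<open>1/3\<close>
  are the integrals of \<open>r\<close> and \<open>r\<^sup>2\<close> over the unit interval.\<close>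

lemma integral_affine_inside_range:
  "integral (inside (range (\<lambda>t. p + u t))) (\<lambda>x. c + k *\<^sub>R (x - p)) = orientation *\<^sub>R
    ((integral {0..T} (\<lambda>t. cross (u t) (u' t)) / 2) *\<^sub>R c +
     (k / 3) *\<^sub>R integral {0..T} (\<lambda>t. cross (u t) (u' t) *\<^sub>R u t))"
    (is "_ = orientation *\<^sub>R ((?A / 2) *\<^sub>R c + (k / 3) *\<^sub>R ?M)")
proof -
  have "((\<lambda>t. cross (u t) (u' t)) has_integral ?A) {0..T}"
    and "((\<lambda>t. cross (u t) (u' t) *\<^sub>R u t) has_integral ?M) {0..T}"
    by (intro integrable_integral integrable_continuous_real continuous_intros continuous_cross continuous)+
  note I = has_integral_add[OF has_integral_scaleR_left[OF this(1)] has_integral_cmul[OF this(2)]]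
  have "((\<lambda>t. (r * cross (u t) (u' t)) *\<^sub>R (c + k *\<^sub>R (p + r *\<^sub>R u t - p))) has_integral
      ?A *\<^sub>R (r *\<^sub>R c) + (r\<^sup>2 * k) *\<^sub>R ?M) {0..T}" for r
    by (rule has_integral_eq[OF _ I]) (simp add: algebra_simps power2_eq_square)
  from integral_unique[OF this] have inner: "integral {0..T} (\<lambda>t. (r * cross (u t) (u' t)) *\<^sub>R (c + k *\<^sub>R (p + r *\<^sub>R u t - p))) =
      r *\<^sub>R (?A *\<^sub>R c) + r\<^sup>2 *\<^sub>R (k *\<^sub>R ?M)" for r
    by (simp only: scaleR_scaleR mult.commute)
  have "((\<lambda>r::real. r) has_integral 1\<^sup>2 / 2 - 0\<^sup>2 / 2) {0..1}"
    by (intro fundamental_theorem_of_calculus)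
      (auto intro!: derivative_eq_intros simp: has_real_derivative_iff_has_vector_derivative[symmetric])
  moreover have "((\<lambda>r::real. r\<^sup>2) has_integral 1 ^ 3 / 3 - 0 ^ 3 / 3) {0..1}"
    by (intro fundamental_theorem_of_calculus)
      (auto intro!: derivative_eq_intros simp: has_real_derivative_iff_has_vector_derivative[symmetric])
  ultimately have "((\<lambda>r. r *\<^sub>R (?A *\<^sub>R c) + r\<^sup>2 *\<^sub>R (k *\<^sub>R ?M)) has_integral
      (1\<^sup>2 / 2 - 0\<^sup>2 / 2) *\<^sub>R (?A *\<^sub>R c) + (1 ^ 3 / 3 - 0 ^ 3 / 3) *\<^sub>R (k *\<^sub>R ?M)) {0..1}"
    by (intro has_integral_add has_integral_scaleR_left)
  then have outer: "integral {0..1} (\<lambda>r. r *\<^sub>R (?A *\<^sub>R c) + r\<^sup>2 *\<^sub>R (k *\<^sub>R ?M)) =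
      (?A / 2) *\<^sub>R c + (k / 3) *\<^sub>R ?M"
    by (simp add: integral_unique)
  have "continuous_on UNIV (\<lambda>x. c + k *\<^sub>R (x - p))"
    by (intro continuous_intros)
  from integral_inside_range[OF this, of p] show ?thesis
    by (simp only: inner outer)
qed

lemma measure_inside_range:
  "measure lebesgue (inside (range (\<lambda>t. p + u t))) =
    orientation * (integral {0..T} (\<lambda>t. cross (u t) (u' t)) / 2)"
    (is "measure lebesgue ?D = _")
proof -
  have "range (\<lambda>t. p + u t) = (\<lambda>t. p + u t) ` {0..<T}"
    by (rule periodic_range[OF period_pos]) (simp add: periodic)
  moreover have "(\<lambda>t. p + u t) ` {0..<T} \<subseteq> (\<lambda>t. p + u t) ` {0..T}"
    by (rule image_mono) auto
  ultimately have "range (\<lambda>t. p + u t) = (\<lambda>t. p + u t) ` {0..T}"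
    by blast
  moreover have "compact ((\<lambda>t. p + u t) ` {0..T})"
    by (intro compact_continuous_image continuous_intros continuous) simp
  ultimately have "compact (range (\<lambda>t. p + u t))"
    by simp
  then have "?D \<in> lmeasurable"
    by (intro lmeasurable_open bounded_inside open_inside) (simp_all add: compact_imp_bounded compact_imp_closed)
  then have "((\<lambda>x. 1::real) has_integral measure lebesgue ?D) ?D"
    using integrable_integral[OF integrable_on_const, of ?D "1::real"] by (simp add: lmeasure_integral)
  \<comment> \<open>A fixed nonzero vector makes the constant integrand vector-valued, as the affine
    formula requires; it is cancelled at the end.\<close>
  from has_integral_scaleR_left[OF this, of "axis 1 1 :: real^2"]
  have "measure lebesgue ?D *\<^sub>R (axis 1 1 :: real^2) = integral ?D (\<lambda>x. axis 1 1 + 0 *\<^sub>R (x - p))"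
    by (simp add: integral_unique)
  also have "\<dots> = (orientation * (integral {0..T} (\<lambda>t. cross (u t) (u' t)) / 2)) *\<^sub>R axis 1 1"
    by (subst integral_affine_inside_range) simp
  finally show ?thesis
    by (simp add: axis_eq_0_iff)
qed

text \<open>Times \<open>orientation\<close> the integrand is
  \<open>\<bar>cross (u t) (u' t)\<bar>\<close>, which is continuous and nonnegative and would have
  to vanish identically.\<close>

lemma integral_cross_nonzero: "integral {0..T} (\<lambda>t. cross (u t) (u' t)) \<noteq> 0"
proof
  assume "integral {0..T} (\<lambda>t. cross (u t) (u' t)) = 0"
  then have "integral {0..T} (\<lambda>t. orientation * cross (u t) (u' t)) = 0"
    by simp
  moreover have "continuous_on {0..T} (\<lambda>t. orientation * cross (u t) (u' t))"
    by (intro continuous_intros continuous_cross)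
  ultimately have "\<forall>t\<in>{0..T}. orientation * cross (u t) (u' t) = 0"
    using integral_eq_0_iff[of 0 T "\<lambda>t. orientation * cross (u t) (u' t)"] period_pos
    by (simp flip: abs_cross)
  then show False
    using period_pos cross_nonzero[of 0] by (auto simp flip: abs_cross)
qed

text \<open>The sign \<open>orientation\<close> occurs in both the moment and the area and cancels;
  the part of the moment due to \<open>p\<close> contributes exactly \<open>p\<close>.\<close>

lemma CM_eq:
  "CM p (\<lambda>t. p + u t) =
    ((1 / 3) *\<^sub>R integral {0..T} (\<lambda>t. cross (u t) (u' t) *\<^sub>R u t)) /\<^sub>R
    (integral {0..T} (\<lambda>t. cross (u t) (u' t)) / 2)"
    (is "_ = ((1 / 3) *\<^sub>R ?M) /\<^sub>R (?A / 2)")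
proof -
  have "integral (inside (range (\<lambda>t. p + u t))) (\<lambda>x. x) =
      orientation *\<^sub>R ((?A / 2) *\<^sub>R p + (1 / 3) *\<^sub>R ?M)"
    using integral_affine_inside_range[of p p 1] by simp
  then have "center_of_mass (inside (range (\<lambda>t. p + u t))) =
      (orientation *\<^sub>R ((?A / 2) *\<^sub>R p + (1 / 3) *\<^sub>R ?M)) /\<^sub>R (orientation * (?A / 2))"
    by (simp only: center_of_mass_def measure_inside_range)
  also have "\<dots> = ((?A / 2) *\<^sub>R p + (1 / 3) *\<^sub>R ?M) /\<^sub>R (?A / 2)"
    using abs_orientation by auto
  also have "\<dots> = p + ((1 / 3) *\<^sub>R ?M) /\<^sub>R (?A / 2)"
    using integral_cross_nonzero by (simp add: scaleR_add_right)
  finally show ?thesis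
    by (simp add: CM_def)
qed

end

section \<open>From the smooth curve and the tangent-line condition to the curve seen from the base
  point\<close>

theorem theorem3:
  fixes \<gamma> :: "real \<Rightarrow> real^2" and T :: real and p :: "real^2"
  assumes "smooth_simple_closed_regular_curve T \<gamma>"
    and "\<forall>t. p \<notin> tangent_line \<gamma> t"
  shows "CCM p T \<gamma> = CM p \<gamma>"
proof -
  define u where "u t = \<gamma> t - p" for t
  define u' where "u' t = vector_derivative \<gamma> (at t)" for t
  have "smooth \<gamma>"
    using assms(1) by (simp add: smooth_simple_closed_regular_curve_def)
  \<comment> \<open>Order \<open>0\<close> gives the derivative of the curve, order \<open>1\<close>
    the continuity of that derivative.\<close>
  then have "((\<lambda>f s. vector_derivative f (at s)) ^^ 0) \<gamma> differentiable (at t)"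
    "((\<lambda>f s. vector_derivative f (at s)) ^^ 1) \<gamma> differentiable (at t)" for t
    unfolding smooth_def by blast+
  then have diff: "\<gamma> differentiable (at t)" "u' differentiable (at t)" for t
    by (simp_all add: u'_def[abs_def])
  interpret starlike_closed_curve u u' T
  proof
    show "0 < T" "u (t + T) = u t" "inj_on u {0..<T}" for t
      using assms(1) by (auto simp: smooth_simple_closed_regular_curve_def u_def inj_on_def)
    show "(u has_vector_derivative u' t) (at t)" for t
      using diff(1)[of t]
      by (simp add: u_def[abs_def] u'_def vector_derivative_works has_vector_derivative_diff_const)
    show "continuous_on UNIV u'"
      using diff(2) by (simp add: continuous_at_imp_continuous_on differentiable_imp_continuous_within)
    show "cross (u t) (u' t) \<noteq> 0" for t
    proof
      assume "cross (u t) (u' t) = 0"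
      moreover have "u' t \<noteq> 0"
        using assms(1) by (simp add: smooth_simple_closed_regular_curve_def u'_def)
      ultimately obtain s where "u t = s *\<^sub>R u' t"
        by (rule cross_eq_0_imp_parallel)
      \<comment> \<open>A vanishing cross product would place \<open>p\<close> on the tangent line
        at \<open>t\<close>, at parameter \<open>- s\<close>.\<close>
      then have "p = \<gamma> t + (- s) *\<^sub>R u' t"
        by (simp add: u_def algebra_simps)
      then have "p \<in> tangent_line \<gamma> t"
        unfolding tangent_line_def u'_def by blast
      with assms(2) show False
        by blast
    qed
  qed
  have "\<gamma> = (\<lambda>t. p + u t)"
    by (simp add: u_def)
  then show ?thesis
    using CCM_eq[of p] CM_eq[of p] by simp
qed

end
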